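(* Let $G=(V,E)$ be a finite graph with $n := |V|$, let $K\in\mathbb{N}$, $K \ge 1$, let $\lambda=(\lambda_v)_{v\in V}\in(0,\infty)^V$ and $p=(p_v)_{v\in V}\in[0,1]^V$. Suppose that there exists $\beta>0$ such that $$\frac1K\sum_{u\in V:\{u,v\}\in E} p_u\,\frac{\lambda_u}{\lambda_v}\le 1-\beta\qquad\text{for all } v\in V.$$ Let $\lambda_{\min}:=\min_{v\in V}\lambda_v$. If $X=(X^t)_{t\ge0}$ and $Y=(Y^t)_{t\ge0}$ are both realisations of the Markov chain $\mathsf{MCH}_\Omega(\lambda,p)$, then for all $t\ge0$ $$\max_{x,y\in\Omega}\bigl\|\mathbb{P}_x[X^t\in\cdot]-\mathbb{P}_y[Y^t\in\cdot]\bigr\|_{\mathsf{TV}}\le\min\bigl\{2n e^{-\beta\lambda_{\min}t},\,1\bigr\}.$$ In particular, $$t_{\mathrm{mix}}(\varepsilon)\le(\beta\lambda_{\min})^{-1}\log(2n/\varepsilon)\qquad\text{for all }\varepsilon\in(0,1).$$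
   Context: Graphs are finite, undirected, without loops or multiple edges, with non-empty vertex set. Write $[K]=\{1,\dots,K\}$ and $[K]_0=\{0,1,\dots,K\}$. State space: $\Omega:=\{\omega\in[K]_0^V : \omega \text{ is proper}\}$, where $\omega=(\omega_v)_{v\in V}$ is proper if $\omega_u\ne\omega_v$ whenever $\{u,v\}\in E$ and $\omega_u+\omega_v>0$. A vertex $v$ is active in $\omega$ if $\omega_v\neq 0$; colour $0$ means inactive. The chain $\mathsf{MCH}_\Omega(\lambda,p)$ (multicoloured hardcore model) is the continuous-time Markov chain on $\Omega$ in which each vertex $v\in V$ is selected for update at rate $\lambda_v$, independently over the vertices. When $v$ is selected, toss a coin $C\sim\mathrm{Bern}(p_v)$ and independently draw a colour $k\sim\mathrm{Unif}([K])$. If $C=1$ and no neighbour of $v$ currently has colour $k$, then set $v$ to colour $k$; otherwise (if $C=0$ or some neighbour has colour $k$), set $v$ to colour $0$. Its equilibrium (invariant) distribution is denoted $\pi$. $\mathbb{P}_x$ denotes the law of the chain started from $x$. Total-variation distance between distributions $\mu,\pi$ on $\Omega$: $\|\mu-\pi\|_{\mathsf{TV}}:=\max_{A\subseteq\Omega}|\mu(A)-\pi(A)|$. Mixing time: $t_{\mathrm{mix}}(\varepsilon):=\inf\{t\ge0 : \max_{x\in\Omega}\|\mathbb{P}_x[X^t\in\cdot]-\pi\|_{\mathsf{TV}}\le\varepsilon\}$. *)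

theory Defs
  imports "HOL-Probability.Probability"
begin

section \<open>Finite simple graphs\<close>

definition simple_graph :: "'v set \<Rightarrow> 'v set set \<Rightarrow> bool" where
  "simple_graph V E \<longleftrightarrow> finite V \<and> V \<noteq> {} \<and> (\<forall>e\<in>E. e \<subseteq> V \<and> card e = 2)"


section \<open>Continuous-time Markov chains on a finite state space\<close>

primrec matrix_power :: "'s set \<Rightarrow> ('s \<Rightarrow> 's \<Rightarrow> real) \<Rightarrow> nat \<Rightarrow> 's \<Rightarrow> 's \<Rightarrow> real" where
  "matrix_power S Q 0 = (\<lambda>x y. of_bool (x = y))"
| "matrix_power S Q (Suc n) = (\<lambda>x y. \<Sum>z\<in>S. Q x z * matrix_power S Q n z y)"

text \<open>The transition function of the chain with rate matrix \<open>Q\<close> is \<open>P\<^sub>t = exp (t Q)\<close>,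
  the matrix exponential being taken over the finite index set \<open>S\<close>.\<close>

definition transition :: "'s set \<Rightarrow> ('s \<Rightarrow> 's \<Rightarrow> real) \<Rightarrow> real \<Rightarrow> 's \<Rightarrow> 's \<Rightarrow> real" where
  "transition S Q t x y = (\<Sum>n. t ^ n / fact n * matrix_power S Q n x y)"

definition transition_law :: "'s set \<Rightarrow> ('s \<Rightarrow> 's \<Rightarrow> real) \<Rightarrow> real \<Rightarrow> 's \<Rightarrow> 's measure" where
  "transition_law S Q t x = point_measure S (\<lambda>y. ennreal (transition S Q t x y))"

text \<open>A process \<open>X\<close> on \<open>M\<close> is a Markov chain with rate matrix \<open>Q\<close> started from \<open>x\<close>: it has
  right-continuous paths in the discrete space \<open>S\<close>, and its finite-dimensional distributions
  are those prescribed by the transition function. The case \<open>n = 0\<close> of the last clause says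
  that \<open>X 0 = x\<close> almost surely.\<close>

definition markov_chain ::
  "'s set \<Rightarrow> ('s \<Rightarrow> 's \<Rightarrow> real) \<Rightarrow> 's \<Rightarrow> 'w measure \<Rightarrow> (real \<Rightarrow> 'w \<Rightarrow> 's) \<Rightarrow> bool" where
  "markov_chain S Q x M X \<longleftrightarrow>
     prob_space M \<and>
     (\<forall>t\<ge>0. X t \<in> M \<rightarrow>\<^sub>M count_space S) \<and>
     (AE w in M. \<forall>t\<ge>0. \<forall>\<^sub>F s in at_right t. X s w = X t w) \<and>
     (\<forall>(n::nat) (ts :: nat \<Rightarrow> real) (xs :: nat \<Rightarrow> 's).
        ts 0 = 0 \<and> (\<forall>i<n. ts i < ts (Suc i)) \<and> (\<forall>i\<le>n. xs i \<in> S) \<longrightarrow>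
        measure M {w \<in> space M. \<forall>i\<le>n. X (ts i) w = xs i} =
          of_bool (xs 0 = x) *
          (\<Prod>i<n. transition S Q (ts (Suc i) - ts i) (xs i) (xs (Suc i))))"

definition invariant_distribution ::
  "'s set \<Rightarrow> ('s \<Rightarrow> 's \<Rightarrow> real) \<Rightarrow> 's pmf \<Rightarrow> bool" where
  "invariant_distribution S Q \<pi> \<longleftrightarrow>
     set_pmf \<pi> \<subseteq> S \<and>
     (\<forall>t\<ge>0. \<forall>y\<in>S. (\<Sum>x\<in>S. pmf \<pi> x * transition S Q t x y) = pmf \<pi> y)"

text \<open>Meaningful when the invariant distribution is unique.\<close>

definition equilibrium :: "'s set \<Rightarrow> ('s \<Rightarrow> 's \<Rightarrow> real) \<Rightarrow> 's pmf" where
  "equilibrium S Q = (THE \<pi>. invariant_distribution S Q \<pi>)"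

definition tv_dist :: "'s set \<Rightarrow> 's measure \<Rightarrow> 's measure \<Rightarrow> real" where
  "tv_dist S \<mu> \<nu> = (MAX A\<in>Pow S. \<bar>measure \<mu> A - measure \<nu> A\<bar>)"

text \<open>Extended-real valued, so that the infimum of the empty set is \<open>\<infinity>\<close>.\<close>

definition mixing_time :: "'s set \<Rightarrow> ('s \<Rightarrow> 's \<Rightarrow> real) \<Rightarrow> real \<Rightarrow> ereal" where
  "mixing_time S Q \<epsilon> =
     Inf (ereal ` {t. 0 \<le> t \<and>
       (MAX x\<in>S. tv_dist S (transition_law S Q t x) (measure_pmf (equilibrium S Q))) \<le> \<epsilon>})"


section \<open>The multicoloured hardcore model\<close>

definition proper :: "'v set set \<Rightarrow> ('v \<Rightarrow> nat) \<Rightarrow> bool" where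
  "proper E x \<longleftrightarrow> (\<forall>u v. {u, v} \<in> E \<and> x u + x v > 0 \<longrightarrow> x u \<noteq> x v)"

definition mch_space :: "'v set \<Rightarrow> 'v set set \<Rightarrow> nat \<Rightarrow> ('v \<Rightarrow> nat) set" where
  "mch_space V E K = {x \<in> V \<rightarrow>\<^sub>E {0..K}. proper E x}"

text \<open>The law of the new configuration when vertex \<open>v\<close> is selected in configuration \<open>x\<close>.\<close>

definition mch_update ::
  "'v set set \<Rightarrow> nat \<Rightarrow> ('v \<Rightarrow> real) \<Rightarrow> 'v \<Rightarrow> ('v \<Rightarrow> nat) \<Rightarrow> ('v \<Rightarrow> nat) pmf" where
  "mch_update E K p v x = do {
     C \<leftarrow> bernoulli_pmf (p v);
     k \<leftarrow> pmf_of_set {1..K};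
     return_pmf (if C \<and> (\<forall>u. {u, v} \<in> E \<longrightarrow> x u \<noteq> k) then x(v := k) else x(v := 0))
   }"

text \<open>Selecting each \<open>v\<close> at rate \<open>\<lambda>\<^sub>v\<close> contributes \<open>\<lambda>\<^sub>v (U\<^sub>v - I)\<close> to the rate matrix, where
  \<open>U\<^sub>v\<close> is the transition matrix of the update at \<open>v\<close>. Updates that leave the configuration
  unchanged cancel.\<close>

definition mch_rates ::
  "'v set \<Rightarrow> 'v set set \<Rightarrow> nat \<Rightarrow> ('v \<Rightarrow> real) \<Rightarrow> ('v \<Rightarrow> real) \<Rightarrow>
   ('v \<Rightarrow> nat) \<Rightarrow> ('v \<Rightarrow> nat) \<Rightarrow> real" where
  "mch_rates V E K lam p x y =
     (\<Sum>v\<in>V. lam v * (pmf (mch_update E K p v x) y - of_bool (x = y)))"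

end

theory Submission imports Defs
begin

text \<open>Embed \<open>[K]\<^sub>0\<close> in \<open>\<ell>\<^sup>1([K])\<close> by sending a colour \<open>k\<close> to the unit vector \<open>e\<^sub>k\<close> and
  0 to the origin, and let the distance of two configurations be the sum over the vertices of the
  \<open>\<ell>\<^sup>1\<close> distances. When two configurations are updated at \<open>v\<close> with the same coin and colour, the
  disagreement at \<open>v\<close> disappears and a new one, of size 1, arises only if the coin succeeds and the
  colour is blocked in exactly one configuration; its expected size is at most \<open>p\<^sub>v / K\<close> times the
  distance on the neighbourhood of \<open>v\<close>. Summing with weights \<open>\<lambda>\<^sub>v\<close>, the hypothesis makes the
  distance contract at rate \<open>\<beta> \<lambda>\<^sub>m\<^sub>i\<^sub>n\<close>. No coupled process is needed: dually, the jump chain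
  contracts Lipschitz constants, and uniformisation transfers this to continuous time. Indicators
  of events have Lipschitz constant 1, and the diameter is at most \<open>2 n\<close>.\<close>

section \<open>Uniformisation\<close>

text \<open>On \<open>S\<close> the matrix \<open>Q\<close> equals \<Lambda> times (\<open>P\<close>
  minus the identity), and \<open>P\<close> commutes with the identity, so this is the binomial
  theorem. The sign exponent \<open>n + k\<close> has the parity of \<open>n - k\<close> and avoids
  truncated subtraction.\<close>

lemma matrix_power_uniformised:
  fixes P Q :: "'s \<Rightarrow> 's \<Rightarrow> real"
  assumes "finite S"
    and Q: "\<And>x y. x \<in> S \<Longrightarrow> y \<in> S \<Longrightarrow> Q x y = \<Lambda> * (P x y - of_bool (x = y))"
    and "x \<in> S"
  shows "matrix_power S Q n x y =
    \<Lambda> ^ n * (\<Sum>k\<le>n. (- 1) ^ (n + k) * real (n choose k) * matrix_power S P k x y)"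
  using \<open>x \<in> S\<close>
proof (induction n arbitrary: x)
  case 0
  then show ?case by simp
next
  case (Suc n)
  let ?b = "\<lambda>n k. (- 1) ^ (n + k) * real (n choose k)"
  let ?M = "\<lambda>k x. matrix_power S P k x y"
  \<comment> \<open>Pascal's rule; the alternating sign turns its sum into a difference.\<close>
  have pascal: "?b (Suc n) (Suc k) = ?b n k - ?b n (Suc k)" for k
    by (simp add: algebra_simps)
  have "matrix_power S Q (Suc n) x y = (\<Sum>z\<in>S. Q x z * matrix_power S Q n z y)"
    by simp
  also have "\<dots> = (\<Sum>z\<in>S. \<Lambda> * (P x z * matrix_power S Q n z y)
      - (if z = x then \<Lambda> * matrix_power S Q n x y else 0))"
    using Suc.prems by (intro sum.cong) (auto simp: Q algebra_simps)
  also have "\<dots> = \<Lambda> * ((\<Sum>z\<in>S. P x z * matrix_power S Q n z y) - matrix_power S Q n x y)"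
    using \<open>finite S\<close> Suc.prems
    by (simp add: sum_subtractf sum_distrib_left algebra_simps)
  also have "(\<Sum>z\<in>S. P x z * matrix_power S Q n z y) =
      (\<Sum>z\<in>S. \<Lambda> ^ n * (\<Sum>k\<le>n. ?b n k * (P x z * ?M k z)))"
    by (intro sum.cong refl) (simp add: Suc.IH sum_distrib_left algebra_simps)
  also have "\<dots> = \<Lambda> ^ n * (\<Sum>z\<in>S. \<Sum>k\<le>n. ?b n k * (P x z * ?M k z))"
    by (rule sum_distrib_left[symmetric])
  also have "(\<Sum>z\<in>S. \<Sum>k\<le>n. ?b n k * (P x z * ?M k z)) =
      (\<Sum>k\<le>n. \<Sum>z\<in>S. ?b n k * (P x z * ?M k z))"
    by (rule sum.swap)
  also have "\<dots> = (\<Sum>k\<le>n. ?b n k * ?M (Suc k) x)"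
    by (simp add: sum_distrib_left)
  finally have "matrix_power S Q (Suc n) x y =
      \<Lambda> ^ Suc n * ((\<Sum>k\<le>n. ?b n k * ?M (Suc k) x) - (\<Sum>k\<le>n. ?b n k * ?M k x))"
    by (simp only: Suc.IH[OF Suc.prems] power_Suc right_diff_distrib mult.assoc)
  \<comment> \<open>The added term \<open>k = Suc n\<close> vanishes because
    \<open>n choose Suc n\<close> is 0. Splitting off \<open>k = 0\<close> then aligns this sum with
    the other one, term by term in the power \<open>Suc k\<close>.\<close>
  also have "(\<Sum>k\<le>n. ?b n k * ?M k x) = (\<Sum>k\<le>Suc n. ?b n k * ?M k x)"
    by simp
  also have "\<dots> = ?b n 0 * ?M 0 x + (\<Sum>k\<le>n. ?b n (Suc k) * ?M (Suc k) x)"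
    by (rule sum.atMost_Suc_shift)
  also have "(\<Sum>k\<le>n. ?b n k * ?M (Suc k) x) -
      (?b n 0 * ?M 0 x + (\<Sum>k\<le>n. ?b n (Suc k) * ?M (Suc k) x)) =
      ?b (Suc n) 0 * ?M 0 x + (\<Sum>k\<le>n. (?b n k - ?b n (Suc k)) * ?M (Suc k) x)"
    by (simp only: left_diff_distrib sum_subtractf) simp
  also have "(\<Sum>k\<le>n. (?b n k - ?b n (Suc k)) * ?M (Suc k) x) =
      (\<Sum>k\<le>n. ?b (Suc n) (Suc k) * ?M (Suc k) x)"
    by (simp only: pascal)
  also have "?b (Suc n) 0 * ?M 0 x + \<dots> = (\<Sum>k\<le>Suc n. ?b (Suc n) k * ?M k x)"
    by (rule sum.atMost_Suc_shift[symmetric])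
  finally show ?case .
qed

text \<open>The definition of \<open>matrix_power\<close> peels off the first factor. Showing that a
  limit of rows of the powers is stationary requires peeling off the last.\<close>

lemma matrix_power_Suc_right:
  assumes "finite S" "y \<in> S" "x \<in> S"
  shows "matrix_power S P (Suc n) x y = (\<Sum>z\<in>S. matrix_power S P n x z * P z y)"
  using \<open>x \<in> S\<close>
proof (induction n arbitrary: x)
  case 0
  then show ?case using assms
    by (simp add: of_bool_def if_distrib[where f = "\<lambda>u. u * _"] if_distrib[where f = "\<lambda>u. _ * u"] cong: if_cong)
next
  case (Suc n)
  have "matrix_power S P (Suc (Suc n)) x y = (\<Sum>z\<in>S. P x z * matrix_power S P (Suc n) z y)"
    by simp
  also have "\<dots> = (\<Sum>z\<in>S. \<Sum>w\<in>S. P x z * (matrix_power S P n z w * P w y))"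
    by (intro sum.cong refl) (simp only: Suc.IH sum_distrib_left)
  also have "\<dots> = (\<Sum>w\<in>S. \<Sum>z\<in>S. P x z * (matrix_power S P n z w * P w y))"
    by (rule sum.swap)
  also have "\<dots> = (\<Sum>w\<in>S. matrix_power S P (Suc n) x w * P w y)"
    by (simp add: sum_distrib_right mult.assoc)
  finally show ?case .
qed

section \<open>Marginals of a Markov chain\<close>

lemma (in prob_space) measure_distr_count_space:
  assumes "f \<in> M \<rightarrow>\<^sub>M count_space S" "finite A" "A \<subseteq> S"
  shows "measure (distr M (count_space S) f) A = (\<Sum>y\<in>A. prob {w \<in> space M. f w = y})"
proof -
  have "measure (distr M (count_space S) f) A = prob (f -` A \<inter> space M)"
    using assms by (intro measure_distr) auto
  also have "f -` A \<inter> space M = (\<Union>y\<in>A. {w \<in> space M. f w = y})"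
    by auto
  also have "prob \<dots> = (\<Sum>y\<in>A. prob {w \<in> space M. f w = y})"
  proof (rule finite_measure_finite_Union)
    show "(\<lambda>y. {w \<in> space M. f w = y}) ` A \<subseteq> events"
    proof safe
      fix y assume "y \<in> A"
      have "{w \<in> space M. f w = y} = f -` {y} \<inter> space M" by auto
      also have "\<dots> \<in> events"
        using \<open>y \<in> A\<close> assms by (intro measurable_sets[OF assms(1)]) auto
      finally show "{w \<in> space M. f w = y} \<in> events" .
    qed
  qed (use assms in \<open>auto simp: disjoint_family_on_def\<close>)
  finally show ?thesis .
qed

text \<open>The cast to \<open>ennreal\<close> sends negative numbers to 0, so nonnegativity is what
  makes the point measure carry the actual transition probabilities.\<close>

lemma measure_transition_law:
  assumes "finite S" "A \<subseteq> S" and nonneg: "\<And>y. y \<in> S \<Longrightarrow> 0 \<le> transition S Q t x y"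
  shows "measure (transition_law S Q t x) A = (\<Sum>y\<in>A. transition S Q t x y)"
proof -
  have "finite A" using assms finite_subset by blast
  have "emeasure (transition_law S Q t x) A = (\<Sum>y\<in>A. ennreal (transition S Q t x y))"
    unfolding transition_law_def using \<open>finite A\<close> \<open>A \<subseteq> S\<close>
    by (subst emeasure_point_measure_finite2) auto
  also have "\<dots> = ennreal (\<Sum>y\<in>A. transition S Q t x y)"
    using assms by (intro sum_ennreal) auto
  finally show ?thesis
    using assms by (simp add: measure_def sum_nonneg subset_iff)
qed

text \<open>In the series only the term \<open>n = 0\<close> survives, since
  \<open>0 ^ 0 = 1\<close>.\<close>

lemma transition_0: "transition S Q 0 x y = of_bool (x = y)"
proof -
  have "(\<lambda>n. 0 ^ n / fact n * matrix_power S Q n x y) sums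
      (\<Sum>n\<in>{0}. 0 ^ n / fact n * matrix_power S Q n x y)"
    by (rule sums_finite) auto
  then show ?thesis by (simp add: transition_def sums_unique[symmetric])
qed

text \<open>The marginal at time \<open>t\<close> is read off the finite-dimensional distribution at
  the two times 0 and \<open>t\<close>. This reduces statements about processes to statements about
  the transition function.\<close>

lemma measure_distr_markov_chain:
  assumes chain: "markov_chain S Q x M X" and "finite S" "x \<in> S" "0 \<le> t" "A \<subseteq> S"
  shows "measure (distr M (count_space S) (X t)) A = (\<Sum>y\<in>A. transition S Q t x y)"
proof -
  interpret prob_space M using chain by (simp add: markov_chain_def)
  have meas: "X s \<in> M \<rightarrow>\<^sub>M count_space S" if "0 \<le> s" for s
    using chain that by (simp add: markov_chain_def)
  have fdd: "prob {w \<in> space M. \<forall>i\<le>n. X (ts i) w = xs i} =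
          of_bool (xs 0 = x) * (\<Prod>i<n. transition S Q (ts (Suc i) - ts i) (xs i) (xs (Suc i)))"
    if "ts 0 = 0" "\<forall>i<n. ts i < ts (Suc i)" "\<forall>i\<le>n. xs i \<in> S" for n ts xs
    using chain that unfolding markov_chain_def by blast
  have start: "prob {w \<in> space M. X 0 w = z} = of_bool (z = x)" if "z \<in> S" for z
    using fdd[of "\<lambda>_. 0" 0 "\<lambda>_. z"] that by simp
  have marginal: "prob {w \<in> space M. X t w = y} = transition S Q t x y" if "y \<in> S" for y
  \<comment> \<open>Observation times must increase strictly, so 0 and \<open>t\<close> are
    admissible together only for positive \<open>t\<close>.\<close>
  proof (cases "t = 0")
    case True
    then show ?thesis using start[OF that] by (auto simp: transition_0)
  next
    case False
    have events: "{w \<in> space M. X s w = z} \<in> events" if "z \<in> S" "0 \<le> s" for s z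
    proof -
      have "{w \<in> space M. X s w = z} = X s -` {z} \<inter> space M" by auto
      also have "\<dots> \<in> events"
        using that by (intro measurable_sets[OF meas]) auto
      finally show ?thesis .
    qed
    have "AE w in M. X 0 w = x"
      using start[OF \<open>x \<in> S\<close>] events[OF \<open>x \<in> S\<close>, of 0] by (simp add: prob_Collect_eq_1)
    \<comment> \<open>Intersecting with the almost sure event \<open>X 0 = x\<close> leaves the
      probability unchanged and produces a two-time cylinder event.\<close>
    then have "prob {w \<in> space M. X t w = y} =
        prob ({w \<in> space M. X 0 w = x} \<inter> {w \<in> space M. X t w = y})"
      using events that \<open>x \<in> S\<close> \<open>0 \<le> t\<close>
      by (intro finite_measure_eq_AE sets.Int) auto
    also have "{w \<in> space M. X 0 w = x} \<inter> {w \<in> space M. X t w = y} =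
        {w \<in> space M. \<forall>i\<le>1::nat. X (if i = 0 then 0 else t) w = (if i = 0 then x else y)}"
      by (auto simp: le_Suc_eq split: if_splits)
    also have "prob \<dots> = transition S Q t x y"
      using fdd[of "\<lambda>i. if i = 0 then 0 else t" 1 "\<lambda>i. if i = 0 then x else y"]
        False \<open>0 \<le> t\<close> \<open>x \<in> S\<close> that by simp
    finally show ?thesis .
  qed
  show ?thesis
    using measure_distr_count_space[OF meas[OF \<open>0 \<le> t\<close>] finite_subset[OF \<open>A \<subseteq> S\<close> \<open>finite S\<close>] \<open>A \<subseteq> S\<close>]
      marginal \<open>A \<subseteq> S\<close> by (simp add: subset_iff cong: sum.cong)
qed

section \<open>Chains contracting Lipschitz constants\<close>

lemma exp_real_sums: "(\<lambda>n. z ^ n / fact n) sums exp z" for z :: real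
  using exp_converges[of z] by (simp add: divide_inverse_commute)

text \<open>\<open>P\<close> is the jump chain obtained from \<open>Q\<close> by uniformisation at
  rate \<Lambda>. The assumption \<open>contraction\<close> is the dual form of a Wasserstein
  contraction by the factor \<open>c\<close>; it is stated for every Lipschitz constant
  \<open>L\<close> so that it can be iterated.\<close>

locale contractive_chain =
  fixes S :: "'s set" and P Q :: "'s \<Rightarrow> 's \<Rightarrow> real" and \<Lambda> c B :: real and d :: "'s \<Rightarrow> 's \<Rightarrow> real"
  assumes finite_S: "finite S" and S_nonempty: "S \<noteq> {}"
    and \<Lambda>_nonneg: "0 \<le> \<Lambda>"
    and rates: "\<And>x y. x \<in> S \<Longrightarrow> y \<in> S \<Longrightarrow> Q x y = \<Lambda> * (P x y - of_bool (x = y))"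
    and P_nonneg: "\<And>x y. x \<in> S \<Longrightarrow> y \<in> S \<Longrightarrow> 0 \<le> P x y"
    and P_sum: "\<And>x. x \<in> S \<Longrightarrow> (\<Sum>y\<in>S. P x y) = 1"
    and c_nonneg: "0 \<le> c" and c_less_1: "c < 1"
    and d_ge: "\<And>x y. x \<in> S \<Longrightarrow> y \<in> S \<Longrightarrow> of_bool (x \<noteq> y) \<le> d x y"
    and d_le: "\<And>x y. x \<in> S \<Longrightarrow> y \<in> S \<Longrightarrow> d x y \<le> B"
    and contraction: "\<And>f L x y. \<lbrakk>0 \<le> L; \<And>x y. x \<in> S \<Longrightarrow> y \<in> S \<Longrightarrow> \<bar>f x - f y\<bar> \<le> L * d x y; x \<in> S; y \<in> S\<rbrakk>
       \<Longrightarrow> \<bar>(\<Sum>z\<in>S. P x z * f z) - (\<Sum>z\<in>S. P y z * f z)\<bar> \<le> c * L * d x y"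
begin

abbreviation "Pn \<equiv> matrix_power S P"

abbreviation "Pt \<equiv> transition S Q"

section \<open>Powers of the jump matrix\<close>

lemma Pn_nonneg: "x \<in> S \<Longrightarrow> y \<in> S \<Longrightarrow> 0 \<le> Pn n x y"
  by (induction n arbitrary: x) (auto intro!: sum_nonneg mult_nonneg_nonneg P_nonneg)

lemma Pn_apply_Suc:
  "(\<Sum>y\<in>S. Pn (Suc n) x y * f y) = (\<Sum>z\<in>S. P x z * (\<Sum>y\<in>S. Pn n z y * f y))"
proof -
  have "(\<Sum>y\<in>S. Pn (Suc n) x y * f y) = (\<Sum>y\<in>S. \<Sum>z\<in>S. P x z * (Pn n z y * f y))"
    by (simp add: sum_distrib_right mult.assoc)
  also have "\<dots> = (\<Sum>z\<in>S. \<Sum>y\<in>S. P x z * (Pn n z y * f y))"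
    by (rule sum.swap)
  finally show ?thesis by (simp add: sum_distrib_left)
qed

lemma Pn_apply_0: "x \<in> S \<Longrightarrow> (\<Sum>y\<in>S. Pn 0 x y * f y) = f x"
  using finite_S by (simp add: of_bool_def if_distrib[where f = "\<lambda>u. u * _"] cong: if_cong)

lemma Pn_sum: "x \<in> S \<Longrightarrow> (\<Sum>y\<in>S. Pn n x y) = 1"
proof (induction n arbitrary: x)
  case 0
  then show ?case using Pn_apply_0[of x "\<lambda>_. 1"] by simp
next
  case (Suc n)
  then show ?case using Pn_apply_Suc[of n x "\<lambda>_. 1"] P_sum by simp
qed

lemma Pn_le_1: "x \<in> S \<Longrightarrow> y \<in> S \<Longrightarrow> Pn n x y \<le> 1"
  using Pn_sum[of x n] member_le_sum[of y S "Pn n x"] finite_S Pn_nonneg by auto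

lemma Pn_lipschitz:
  assumes "\<And>x y. x \<in> S \<Longrightarrow> y \<in> S \<Longrightarrow> \<bar>f x - f y\<bar> \<le> d x y" and "x \<in> S" "y \<in> S"
  shows "\<bar>(\<Sum>z\<in>S. Pn n x z * f z) - (\<Sum>z\<in>S. Pn n y z * f z)\<bar> \<le> c ^ n * d x y"
  using \<open>x \<in> S\<close> \<open>y \<in> S\<close>
proof (induction n arbitrary: x y)
  case 0
  then show ?case using assms(1) by (simp only: Pn_apply_0) simp
next
  case (Suc n)
  show ?case
    \<comment> \<open>\<open>contraction\<close> is applied to the function \<open>z\<close>
      \<mapsto> (\<open>P\<close>^n f)(z), whose Lipschitz constant is \<open>c ^ n\<close> by
      induction.\<close>
    unfolding Pn_apply_Suc power_Suc
    by (rule contraction) (use Suc c_nonneg in auto)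
qed

section \<open>The transition function in continuous time\<close>

text \<open>The identity exp(\<Lambda>t) exp(tQ) = exp(\<Lambda>tP), entry by entry. The series for
  exp(\<Lambda>tP) and for exp(-\<Lambda>t) converge absolutely, and
  \<open>matrix_power_uniformised\<close> identifies their Cauchy product with the series defining
  \<open>transition\<close>.\<close>

lemma Pt_uniformised:
  assumes "x \<in> S" "y \<in> S" "0 \<le> t"
  shows "(\<lambda>n. (\<Lambda> * t) ^ n / fact n * Pn n x y) sums (exp (\<Lambda> * t) * Pt t x y)"
proof -
  define a where "a k = (\<Lambda> * t) ^ k / fact k * Pn k x y" for k
  define b where "b k = (- (\<Lambda> * t)) ^ k / fact k" for k
  have "summable (\<lambda>k. norm (a k))"
  proof (rule summable_comparison_test')
    show "summable (\<lambda>k. (\<Lambda> * t) ^ k / fact k)" by (rule sums_summable[OF exp_real_sums])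
    show "norm (norm (a k)) \<le> (\<Lambda> * t) ^ k / fact k" for k
      using assms \<Lambda>_nonneg Pn_nonneg[of x y k] Pn_le_1[of x y k]
      by (simp add: a_def abs_mult power_abs divide_right_mono mult_left_le)
  qed
  moreover have "summable (\<lambda>k. norm (b k))"
  proof -
    have "norm (b k) = (\<Lambda> * t) ^ k / fact k" for k
      using assms \<Lambda>_nonneg by (simp add: b_def power_abs)
    then show ?thesis using sums_summable[OF exp_real_sums[of "\<Lambda> * t"]] by simp
  qed
  ultimately have "(\<lambda>n. \<Sum>k\<le>n. a k * b (n - k)) sums (suminf a * suminf b)"
    by (rule Cauchy_product_sums)
  also have "(\<lambda>n. \<Sum>k\<le>n. a k * b (n - k)) = (\<lambda>n. t ^ n / fact n * matrix_power S Q n x y)"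
  proof
    fix n
    have "a k * b (n - k) =
        t ^ n / fact n * (\<Lambda> ^ n * ((- 1) ^ (n + k) * real (n choose k) * Pn k x y))"
      if "k \<le> n" for k
    proof -
      have "(- (\<Lambda> * t)) ^ (n - k) = (- 1) ^ (n + k) * (\<Lambda> * t) ^ (n - k)"
      proof -
        have "even (n - k) = even (n + k)" using that by simp
        then have "(- 1 :: real) ^ (n - k) = (- 1) ^ (n + k)"
          by (cases "even (n + k)") auto
        then show ?thesis by (subst power_minus) simp
      qed
      moreover have "(\<Lambda> * t) ^ k * (\<Lambda> * t) ^ (n - k) = t ^ n * \<Lambda> ^ n"
        using that by (simp only: power_add[symmetric]) (simp add: power_mult_distrib)
      moreover have "real (n choose k) / fact n = 1 / (fact k * fact (n - k))"
        using that by (simp add: binomial_fact)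
      ultimately show ?thesis
        by (simp add: a_def b_def binomial_fact that)
    qed
    then have "(\<Sum>k\<le>n. a k * b (n - k)) = (\<Sum>k\<le>n. t ^ n / fact n *
        (\<Lambda> ^ n * ((- 1) ^ (n + k) * real (n choose k) * Pn k x y)))"
      by (intro sum.cong) auto
    then show "(\<Sum>k\<le>n. a k * b (n - k)) = t ^ n / fact n * matrix_power S Q n x y"
      using matrix_power_uniformised[OF finite_S rates \<open>x \<in> S\<close>]
      by (simp add: sum_distrib_left)
  qed
  finally have "Pt t x y = suminf a * suminf b"
    unfolding transition_def by (simp add: sums_iff)
  moreover have "suminf b = exp (- (\<Lambda> * t))"
    unfolding b_def by (rule sums_unique[OF exp_real_sums, symmetric])
  moreover have "a sums suminf a"
    using \<open>summable (\<lambda>k. norm (a k))\<close> summable_norm_cancel summable_sums by blast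
  ultimately have "a sums (exp (\<Lambda> * t) * Pt t x y)"
    by (simp add: exp_minus mult.left_commute[of "exp (\<Lambda> * t)"])
  then show ?thesis unfolding a_def .
qed

lemma Pt_apply_sums:
  assumes "x \<in> S" "0 \<le> t" "A \<subseteq> S"
  shows "(\<lambda>n. (\<Lambda> * t) ^ n / fact n * (\<Sum>y\<in>A. Pn n x y * f y)) sums
    (exp (\<Lambda> * t) * (\<Sum>y\<in>A. Pt t x y * f y))"
proof -
  have "(\<lambda>n. \<Sum>y\<in>A. (\<Lambda> * t) ^ n / fact n * Pn n x y * f y) sums
      (\<Sum>y\<in>A. exp (\<Lambda> * t) * Pt t x y * f y)"
    using assms by (intro sums_sum sums_mult2 Pt_uniformised) auto
  then show ?thesis by (simp add: sum_distrib_left mult.assoc)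
qed

text \<open>The defining series of \<open>transition\<close> may have terms of both signs, but the
  uniformised series has nonnegative terms.\<close>

lemma Pt_nonneg:
  assumes "x \<in> S" "y \<in> S" "0 \<le> t"
  shows "0 \<le> Pt t x y"
proof -
  have "0 \<le> exp (\<Lambda> * t) * Pt t x y"
    using assms \<Lambda>_nonneg Pn_nonneg
    by (intro sums_le[OF _ sums_zero Pt_uniformised]) auto
  then show ?thesis by (simp add: zero_le_mult_iff)
qed

lemma Pt_sum:
  assumes "x \<in> S" "0 \<le> t"
  shows "(\<Sum>y\<in>S. Pt t x y) = 1"
  using Pt_apply_sums[OF assms order.refl, of "\<lambda>_. 1"] sums_unique2[OF exp_real_sums[of "\<Lambda> * t"]]
  by (fastforce simp: Pn_sum[OF \<open>x \<in> S\<close>])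

text \<open>The number of jumps up to time \<open>t\<close> is Poisson with mean \<Lambda>t, and
  \<open>n\<close> jumps contract by \<open>c ^ n\<close>. The Poisson average of
  \<open>c ^ n\<close> is exp(-\<Lambda>(1 - c)t).\<close>

lemma Pt_lipschitz:
  assumes f: "\<And>x y. x \<in> S \<Longrightarrow> y \<in> S \<Longrightarrow> \<bar>f x - f y\<bar> \<le> d x y"
    and xy: "x \<in> S" "y \<in> S" and "0 \<le> t"
  shows "\<bar>(\<Sum>z\<in>S. Pt t x z * f z) - (\<Sum>z\<in>S. Pt t y z * f z)\<bar> \<le> exp (- \<Lambda> * (1 - c) * t) * d x y"
proof -
  \<comment> \<open>The term of the difference of the two uniformised series that belongs to
    \<open>n\<close> jumps; the factor exp(\<Lambda>t) is divided out at the end.\<close>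
  define D where "D n = (\<Lambda> * t) ^ n / fact n *
      ((\<Sum>z\<in>S. Pn n x z * f z) - (\<Sum>z\<in>S. Pn n y z * f z))" for n
  let ?\<Delta> = "(\<Sum>z\<in>S. Pt t x z * f z) - (\<Sum>z\<in>S. Pt t y z * f z)"
  have D: "D sums (exp (\<Lambda> * t) * ?\<Delta>)"
    unfolding D_def right_diff_distrib
    using assms by (intro sums_diff Pt_apply_sums) auto
  have bound: "(\<lambda>n. (\<Lambda> * t * c) ^ n / fact n * d x y) sums (exp (\<Lambda> * t * c) * d x y)"
    by (intro sums_mult2 exp_real_sums)
  have D_le: "\<bar>D n\<bar> \<le> (\<Lambda> * t * c) ^ n / fact n * d x y" for n
  proof -
    have "\<bar>D n\<bar> = (\<Lambda> * t) ^ n / fact n *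
        \<bar>(\<Sum>z\<in>S. Pn n x z * f z) - (\<Sum>z\<in>S. Pn n y z * f z)\<bar>"
      using \<Lambda>_nonneg \<open>0 \<le> t\<close> by (simp add: D_def abs_mult power_abs)
    also have "\<dots> \<le> (\<Lambda> * t) ^ n / fact n * (c ^ n * d x y)"
      using Pn_lipschitz[OF f xy, where n = n] \<Lambda>_nonneg \<open>0 \<le> t\<close>
      by (intro mult_left_mono) auto
    finally show ?thesis by (simp add: power_mult_distrib)
  qed
  have "exp (\<Lambda> * t) * ?\<Delta> \<le> exp (\<Lambda> * t * c) * d x y"
    using D_le by (intro sums_le[OF _ D bound]) (simp add: abs_le_iff)
  moreover have "- (exp (\<Lambda> * t) * ?\<Delta>) \<le> exp (\<Lambda> * t * c) * d x y"
    using D_le by (intro sums_le[OF _ sums_minus[OF D] bound]) (simp add: abs_le_iff)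
  ultimately have "\<bar>exp (\<Lambda> * t) * ?\<Delta>\<bar> \<le> exp (\<Lambda> * t * c) * d x y"
    by (rule abs_leI)
  then have "exp (\<Lambda> * t) * \<bar>?\<Delta>\<bar> \<le> exp (\<Lambda> * t * c) * d x y"
    by (simp only: abs_mult abs_exp_cancel)
  then have "\<bar>?\<Delta>\<bar> \<le> exp (\<Lambda> * t * c) / exp (\<Lambda> * t) * d x y"
    by (simp add: field_simps)
  also have "exp (\<Lambda> * t * c) / exp (\<Lambda> * t) = exp (- \<Lambda> * (1 - c) * t)"
    by (simp add: exp_diff[symmetric] algebra_simps)
  finally show ?thesis .
qed

text \<open>The indicator of \<open>A\<close> has Lipschitz constant 1 because \<open>d\<close>
  dominates the discrete metric; afterwards \<open>d\<close> is bounded by \<open>B\<close>.\<close>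

lemma Pt_set_diff_le:
  assumes "x \<in> S" "y \<in> S" "0 \<le> t" "A \<subseteq> S"
  shows "\<bar>(\<Sum>z\<in>A. Pt t x z) - (\<Sum>z\<in>A. Pt t y z)\<bar> \<le> B * exp (- \<Lambda> * (1 - c) * t)"
proof -
  have set: "(\<Sum>z\<in>S. g z * of_bool (z \<in> A)) = (\<Sum>z\<in>A. g z)" for g :: "'s \<Rightarrow> real"
  proof -
    have "A = S \<inter> {z. z \<in> A}" using \<open>A \<subseteq> S\<close> by blast
    then show ?thesis
      using finite_S by (simp add: of_bool_def if_distrib[where f = "\<lambda>u. _ * u"] sum.If_cases cong: if_cong)
  qed
  have "\<bar>(\<Sum>z\<in>S. Pt t x z * of_bool (z \<in> A)) - (\<Sum>z\<in>S. Pt t y z * of_bool (z \<in> A))\<bar>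
      \<le> exp (- \<Lambda> * (1 - c) * t) * d x y"
  proof (rule Pt_lipschitz)
    show "\<bar>of_bool (u \<in> A) - of_bool (v \<in> A)\<bar> \<le> d u v" if "u \<in> S" "v \<in> S" for u v
      using d_ge[OF that] by (auto split: if_splits simp: of_bool_def)
  qed (use assms in auto)
  also have "\<dots> \<le> exp (- \<Lambda> * (1 - c) * t) * B"
    using assms d_le by (intro mult_left_mono) auto
  finally show ?thesis by (simp only: set mult.commute[of B])
qed

section \<open>Existence of an invariant distribution\<close>

text \<open>The rows of \<open>P\<^sup>n\<close> form a Cauchy sequence, since \<open>P\<^sup>n\<^sup>+\<^sup>1 x\<^sub>0 y\<close> is an average of the
  values \<open>P\<^sup>n z y\<close>, which lie within \<open>B c\<^sup>n\<close> of one another.\<close>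

lemma Pn_convergent:
  assumes "x \<in> S" "y \<in> S"
  shows "convergent (\<lambda>n. Pn n x y)"
proof -
  have step: "\<bar>Pn (Suc n) x y - Pn n x y\<bar> \<le> c ^ n * B" for n
  proof -
    have single: "(\<Sum>z\<in>S. g z * of_bool (z = y)) = g y" for g :: "'s \<Rightarrow> real"
      using finite_S assms by (simp add: of_bool_def if_distrib[where f = "\<lambda>u. _ * u"] cong: if_cong)
    \<comment> \<open>The column \<open>y\<close> of the matrix power is the power applied to the
      indicator of \<open>y\<close>, so \<open>Pn_lipschitz\<close> bounds its oscillation.\<close>
    have osc: "\<bar>Pn n z y - Pn n x y\<bar> \<le> c ^ n * B" if "z \<in> S" for z
    proof -
      have "\<bar>(\<Sum>w\<in>S. Pn n z w * of_bool (w = y)) - (\<Sum>w\<in>S. Pn n x w * of_bool (w = y))\<bar>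
          \<le> c ^ n * d z x"
      proof (rule Pn_lipschitz)
        show "\<bar>of_bool (u = y) - of_bool (v = y)\<bar> \<le> d u v" if "u \<in> S" "v \<in> S" for u v
          using d_ge[OF that] by (auto split: if_splits simp: of_bool_def)
      qed (use assms that in auto)
      also have "\<dots> \<le> c ^ n * B"
        using assms that d_le c_nonneg by (intro mult_left_mono) auto
      finally show ?thesis by (simp only: single)
    qed
    have "Pn (Suc n) x y - Pn n x y = (\<Sum>z\<in>S. P x z * (Pn n z y - Pn n x y))"
      using P_sum[OF \<open>x \<in> S\<close>]
      by (simp add: right_diff_distrib sum_subtractf sum_distrib_right[symmetric])
    also have "\<bar>\<dots>\<bar> \<le> (\<Sum>z\<in>S. P x z * (c ^ n * B))"
      using osc assms P_nonneg
      by (intro sum_abs[THEN order.trans] sum_mono) (auto simp: abs_mult intro!: mult_left_mono)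
    also have "\<dots> = c ^ n * B"
      using P_sum[OF \<open>x \<in> S\<close>] by (simp add: sum_distrib_right[symmetric])
    finally show ?thesis .
  qed
  have "summable (\<lambda>n. Pn (Suc n) x y - Pn n x y)"
  proof (rule summable_comparison_test')
    show "summable (\<lambda>n. c ^ n * B)"
      using c_nonneg c_less_1 by (intro summable_mult2 summable_geometric) auto
    show "norm (Pn (Suc n) x y - Pn n x y) \<le> c ^ n * B" for n
      using step by simp
  qed
  then have "convergent (\<lambda>n. \<Sum>k<n. Pn (Suc k) x y - Pn k x y)"
    by (simp only: summable_iff_convergent)
  then have "convergent (\<lambda>n. Pn n x y - Pn 0 x y)"
    by (simp only: sum_lessThan_telescope[of "\<lambda>n. Pn n x y"])
  then have "convergent (\<lambda>n. Pn n x y - Pn 0 x y + Pn 0 x y)"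
    by (intro convergent_add convergent_const)
  then show ?thesis by simp
qed

text \<open>The limit of a row of the powers of \<open>P\<close> is a probability vector fixed by
  \<open>P\<close>, hence by all powers of \<open>P\<close>, hence by the transition function
  through the uniformised series.\<close>

lemma exists_invariant_distribution: "\<exists>\<pi>. invariant_distribution S Q \<pi>"
proof -
  obtain x where "x \<in> S" using S_nonempty by blast
  \<comment> \<open>The value 0 outside \<open>S\<close> confines the support of the resulting
    \<open>pmf\<close> to \<open>S\<close>.\<close>
  define \<nu> where "\<nu> y = (if y \<in> S then lim (\<lambda>n. Pn n x y) else 0)" for y
  have lim: "(\<lambda>n. Pn n x y) \<longlonglongrightarrow> \<nu> y" if "y \<in> S" for y
    using Pn_convergent[OF \<open>x \<in> S\<close> that] that by (simp add: \<nu>_def convergent_LIMSEQ_iff)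
  have nonneg: "0 \<le> \<nu> y" for y
    using LIMSEQ_le_const[OF lim[of y], of 0] Pn_nonneg[OF \<open>x \<in> S\<close>] by (cases "y \<in> S") (auto simp: \<nu>_def)
  have sum1: "(\<Sum>y\<in>S. \<nu> y) = 1"
  proof -
    have "(\<lambda>n. \<Sum>y\<in>S. Pn n x y) \<longlonglongrightarrow> (\<Sum>y\<in>S. \<nu> y)"
      by (intro tendsto_sum lim)
    then show ?thesis using Pn_sum[OF \<open>x \<in> S\<close>] by (simp add: LIMSEQ_const_iff)
  qed
  have stationary: "(\<Sum>z\<in>S. \<nu> z * P z y) = \<nu> y" if "y \<in> S" for y
  proof (rule LIMSEQ_unique)
    show "(\<lambda>n. \<Sum>z\<in>S. Pn n x z * P z y) \<longlonglongrightarrow> (\<Sum>z\<in>S. \<nu> z * P z y)"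
      by (intro tendsto_sum tendsto_mult lim tendsto_const)
    \<comment> \<open>Multiplying the row by \<open>P\<close> on the right only advances the
      sequence by one index.\<close>
    show "(\<lambda>n. \<Sum>z\<in>S. Pn n x z * P z y) \<longlonglongrightarrow> \<nu> y"
      using LIMSEQ_Suc[OF lim[OF that]]
      by (simp only: matrix_power_Suc_right[OF finite_S that \<open>x \<in> S\<close>])
  qed
  have stationary_Pn: "(\<Sum>z\<in>S. \<nu> z * Pn n z y) = \<nu> y" if "y \<in> S" for y n
  proof (induction n)
    case 0
    then show ?case using that finite_S
      by (simp add: of_bool_def if_distrib[where f = "\<lambda>u. _ * u"] cong: if_cong)
  next
    case (Suc n)
    have "(\<Sum>z\<in>S. \<nu> z * Pn (Suc n) z y) = (\<Sum>z\<in>S. \<Sum>w\<in>S. \<nu> z * P z w * Pn n w y)"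
      by (simp add: sum_distrib_left mult.assoc)
    also have "\<dots> = (\<Sum>w\<in>S. \<Sum>z\<in>S. \<nu> z * P z w * Pn n w y)"
      by (rule sum.swap)
    also have "\<dots> = (\<Sum>w\<in>S. \<nu> w * Pn n w y)"
      by (simp add: sum_distrib_right[symmetric] stationary)
    finally show ?case using Suc by simp
  qed
  have total: "(\<integral>\<^sup>+y. ennreal (\<nu> y) \<partial>count_space UNIV) = 1"
  proof -
    have "(\<integral>\<^sup>+y. ennreal (\<nu> y) \<partial>count_space UNIV) = (\<Sum>y\<in>S. ennreal (\<nu> y))"
      using finite_S by (intro nn_integral_count_space'[of S]) (auto simp: \<nu>_def)
    also have "\<dots> = 1" using nonneg sum1 by simp
    finally show ?thesis .
  qed
  have pmf: "pmf (embed_pmf \<nu>) y = \<nu> y" for y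
    by (rule pmf_embed_pmf[OF nonneg total])
  have "(\<Sum>z\<in>S. \<nu> z * Pt t z y) = \<nu> y" if "0 \<le> t" "y \<in> S" for t y
  proof -
    have "(\<lambda>n. \<Sum>z\<in>S. \<nu> z * ((\<Lambda> * t) ^ n / fact n * Pn n z y)) sums
        (\<Sum>z\<in>S. \<nu> z * (exp (\<Lambda> * t) * Pt t z y))"
      using that by (intro sums_sum sums_mult Pt_uniformised) auto
    moreover have "(\<Sum>z\<in>S. \<nu> z * ((\<Lambda> * t) ^ n / fact n * Pn n z y)) = (\<Lambda> * t) ^ n / fact n * \<nu> y" for n
      by (subst stationary_Pn[OF \<open>y \<in> S\<close>, of n, symmetric]) (simp add: sum_distrib_left mult_ac)
    ultimately have "(\<lambda>n. (\<Lambda> * t) ^ n / fact n * \<nu> y) sums (\<Sum>z\<in>S. \<nu> z * (exp (\<Lambda> * t) * Pt t z y))"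
      by simp
    then have "(\<Sum>z\<in>S. \<nu> z * (exp (\<Lambda> * t) * Pt t z y)) = exp (\<Lambda> * t) * \<nu> y"
      using sums_unique2 sums_mult2[OF exp_real_sums] by blast
    moreover have "(\<Sum>z\<in>S. \<nu> z * (exp (\<Lambda> * t) * Pt t z y)) = exp (\<Lambda> * t) * (\<Sum>z\<in>S. \<nu> z * Pt t z y)"
      by (simp add: sum_distrib_left mult_ac)
    ultimately show ?thesis by simp
  qed
  moreover have "set_pmf (embed_pmf \<nu>) \<subseteq> S"
    by (auto simp: set_pmf_eq pmf \<nu>_def split: if_splits)
  ultimately have "invariant_distribution S Q (embed_pmf \<nu>)"
    by (simp add: invariant_distribution_def pmf)
  then show ?thesis by blast
qed

section \<open>Convergence to equilibrium\<close>

lemma invariant_distribution_set: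
  assumes "invariant_distribution S Q \<pi>" "A \<subseteq> S" "0 \<le> t"
  shows "measure (measure_pmf \<pi>) A = (\<Sum>y\<in>S. pmf \<pi> y * (\<Sum>z\<in>A. Pt t y z))"
proof -
  have "measure (measure_pmf \<pi>) A = (\<Sum>z\<in>A. pmf \<pi> z)"
    using finite_subset[OF \<open>A \<subseteq> S\<close> finite_S] by (rule measure_measure_pmf_finite)
  also have "\<dots> = (\<Sum>z\<in>A. \<Sum>y\<in>S. pmf \<pi> y * Pt t y z)"
    using assms by (intro sum.cong) (auto simp: invariant_distribution_def subset_iff)
  also have "\<dots> = (\<Sum>y\<in>S. \<Sum>z\<in>A. pmf \<pi> y * Pt t y z)"
    by (rule sum.swap)
  finally show ?thesis by (simp add: sum_distrib_left)
qed

text \<open>By invariance \<pi>(A) is the \<pi>-average over starting points \<open>y\<close> of the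
  probability of \<open>A\<close> at time \<open>t\<close>. The bound for two starting points
  therefore passes to the average.\<close>

lemma Pt_invariant_diff_le:
  assumes inv: "invariant_distribution S Q \<pi>" and "x \<in> S" "0 \<le> t" "A \<subseteq> S"
  shows "\<bar>(\<Sum>z\<in>A. Pt t x z) - measure (measure_pmf \<pi>) A\<bar> \<le> B * exp (- \<Lambda> * (1 - c) * t)"
    (is "_ \<le> ?bound")
proof -
  have sum1: "(\<Sum>y\<in>S. pmf \<pi> y) = 1"
    using inv finite_S by (intro sum_pmf_eq_1) (auto simp: invariant_distribution_def)
  have "(\<Sum>z\<in>A. Pt t x z) - measure (measure_pmf \<pi>) A =
      (\<Sum>y\<in>S. pmf \<pi> y * ((\<Sum>z\<in>A. Pt t x z) - (\<Sum>z\<in>A. Pt t y z)))"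
    unfolding invariant_distribution_set[OF inv \<open>A \<subseteq> S\<close> \<open>0 \<le> t\<close>]
    by (simp add: right_diff_distrib sum_subtractf sum_distrib_right[symmetric] sum1)
  also have "\<bar>\<dots>\<bar> \<le> (\<Sum>y\<in>S. pmf \<pi> y * ?bound)"
    using Pt_set_diff_le[OF \<open>x \<in> S\<close> _ \<open>0 \<le> t\<close> \<open>A \<subseteq> S\<close>]
    by (intro sum_abs[THEN order.trans] sum_mono) (auto simp: abs_mult intro!: mult_left_mono)
  also have "\<dots> = ?bound"
    by (simp add: sum_distrib_right[symmetric] sum1)
  finally show ?thesis .
qed

lemma Pt_tendsto_invariant:
  assumes "invariant_distribution S Q \<pi>" "0 < \<Lambda>" "x \<in> S" "y \<in> S"
  shows "((\<lambda>t. Pt t x y) \<longlongrightarrow> pmf \<pi> y) at_top"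
proof -
  have "((\<lambda>t. B * exp (- \<Lambda> * (1 - c) * t)) \<longlongrightarrow> 0) at_top"
  proof -
    have "filterlim (\<lambda>t. \<Lambda> * (1 - c) * t) at_top at_top"
      using \<open>0 < \<Lambda>\<close> c_less_1
      by (intro filterlim_tendsto_pos_mult_at_top[OF tendsto_const] filterlim_ident) auto
    then have "((\<lambda>t. exp (- (\<Lambda> * (1 - c) * t))) \<longlongrightarrow> 0) at_top"
      by (intro filterlim_compose[OF exp_at_bot] filterlim_compose[OF filterlim_uminus_at_bot_at_top])
    then show ?thesis by (intro tendsto_mult_right_zero) simp
  qed
  moreover have "\<forall>\<^sub>F t in at_top. norm (Pt t x y - pmf \<pi> y) \<le> B * exp (- \<Lambda> * (1 - c) * t)"
    using eventually_ge_at_top[of 0]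
  proof eventually_elim
    case (elim t)
    show ?case
      using Pt_invariant_diff_le[OF assms(1) \<open>x \<in> S\<close> elim, of "{y}"] \<open>y \<in> S\<close>
      by (simp add: measure_pmf_single)
  qed
  ultimately have "((\<lambda>t. Pt t x y - pmf \<pi> y) \<longlongrightarrow> 0) at_top"
    by (rule Lim_null_comparison[rotated])
  then show ?thesis by (simp add: LIM_zero_iff)
qed

text \<open>Since \<open>equilibrium\<close> is a definite description, uniqueness is required as
  well: on \<open>S\<close> any two invariant distributions are the limit of the same transition
  probabilities, and both vanish outside \<open>S\<close>.\<close>

lemma invariant_equilibrium:
  assumes "0 < \<Lambda>"
  shows "invariant_distribution S Q (equilibrium S Q)"
proof -
  obtain x where "x \<in> S" using S_nonempty by blast
  have "\<pi> = \<pi>'" if inv: "invariant_distribution S Q \<pi>" "invariant_distribution S Q \<pi>'" for \<pi> \<pi>'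
  proof (rule pmf_eqI)
    fix y
    show "pmf \<pi> y = pmf \<pi>' y"
    proof (cases "y \<in> S")
      case True
      then show ?thesis
        using Pt_tendsto_invariant[OF _ assms \<open>x \<in> S\<close> True] inv
        by (auto intro: tendsto_unique[OF trivial_limit_at_top_linorder])
    next
      case False
      then have "y \<notin> set_pmf \<pi>" "y \<notin> set_pmf \<pi>'"
        using inv by (auto simp: invariant_distribution_def)
      then show ?thesis by (simp add: set_pmf_iff)
    qed
  qed
  then have "\<exists>!\<pi>. invariant_distribution S Q \<pi>"
    using exists_invariant_distribution by blast
  then show ?thesis unfolding equilibrium_def by (rule theI')
qed

section \<open>Mixing time and total variation for contracting chains\<close>

text \<open>The condition on \<open>t\<close> puts \<open>t\<close> itself into the set whose
  infimum is the mixing time.\<close>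

lemma mixing_time_le:
  assumes "0 < \<Lambda>" "0 \<le> t" "B * exp (- \<Lambda> * (1 - c) * t) \<le> \<epsilon>"
  shows "mixing_time S Q \<epsilon> \<le> ereal t"
proof -
  have "tv_dist S (transition_law S Q t x) (measure_pmf (equilibrium S Q)) \<le> \<epsilon>" if "x \<in> S" for x
    unfolding tv_dist_def
  proof (subst Max_le_iff)
    show "\<forall>a\<in>(\<lambda>A. \<bar>measure (transition_law S Q t x) A - measure (measure_pmf (equilibrium S Q)) A\<bar>) ` Pow S. a \<le> \<epsilon>"
      using Pt_invariant_diff_le[OF invariant_equilibrium[OF assms(1)] that \<open>0 \<le> t\<close>]
        measure_transition_law[OF finite_S _ Pt_nonneg[OF that _ \<open>0 \<le> t\<close>]] assms(3)
      by (auto intro: order.trans)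
  qed (use finite_S in auto)
  then have "(MAX x\<in>S. tv_dist S (transition_law S Q t x) (measure_pmf (equilibrium S Q))) \<le> \<epsilon>"
    using finite_S S_nonempty by (subst Max_le_iff) auto
  then show ?thesis
    unfolding mixing_time_def using \<open>0 \<le> t\<close> by (intro INF_lower) auto
qed

lemma tv_dist_markov_chains_le:
  assumes "\<forall>x\<in>S. markov_chain S Q x (PX x) X" "\<forall>y\<in>S. markov_chain S Q y (PY y) Y" "0 \<le> t"
  shows "(MAX x\<in>S. MAX y\<in>S. tv_dist S (distr (PX x) (count_space S) (X t)) (distr (PY y) (count_space S) (Y t)))
    \<le> min (B * exp (- \<Lambda> * (1 - c) * t)) 1"
proof -
  have "\<bar>measure (distr (PX x) (count_space S) (X t)) A - measure (distr (PY y) (count_space S) (Y t)) A\<bar>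
      \<le> min (B * exp (- \<Lambda> * (1 - c) * t)) 1" if xy: "x \<in> S" "y \<in> S" and A: "A \<subseteq> S" for x y A
  proof -
    have X: "measure (distr (PX x) (count_space S) (X t)) A = (\<Sum>z\<in>A. Pt t x z)"
      using assms xy A finite_S by (intro measure_distr_markov_chain) auto
    have Y: "measure (distr (PY y) (count_space S) (Y t)) A = (\<Sum>z\<in>A. Pt t y z)"
      using assms xy A finite_S by (intro measure_distr_markov_chain) auto
    \<comment> \<open>Source of the bound 1 in the minimum: two numbers in the unit interval differ
      by at most 1.\<close>
    have prob: "0 \<le> (\<Sum>z\<in>A. Pt t u z) \<and> (\<Sum>z\<in>A. Pt t u z) \<le> 1" if "u \<in> S" for u
    proof
      show "0 \<le> (\<Sum>z\<in>A. Pt t u z)"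
        using that A Pt_nonneg \<open>0 \<le> t\<close> by (intro sum_nonneg) auto
      have "(\<Sum>z\<in>A. Pt t u z) \<le> (\<Sum>z\<in>S. Pt t u z)"
        using that A finite_S Pt_nonneg \<open>0 \<le> t\<close> by (intro sum_mono2) auto
      then show "(\<Sum>z\<in>A. Pt t u z) \<le> 1" using Pt_sum[OF that \<open>0 \<le> t\<close>] by simp
    qed
    show ?thesis
      using Pt_set_diff_le[OF xy \<open>0 \<le> t\<close> A] prob[OF xy(1)] prob[OF xy(2)] unfolding X Y by auto
  qed
  then have "tv_dist S (distr (PX x) (count_space S) (X t)) (distr (PY y) (count_space S) (Y t))
      \<le> min (B * exp (- \<Lambda> * (1 - c) * t)) 1" if "x \<in> S" "y \<in> S" for x y
    unfolding tv_dist_def using finite_S that by (intro Max.boundedI) auto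
  then show ?thesis
    using finite_S S_nonempty by (intro Max.boundedI) (auto intro!: Max.boundedI)
qed

end

section \<open>The multicoloured hardcore model\<close>

locale mch =
  fixes V :: "'v set" and E :: "'v set set" and K :: nat
    and lam p :: "'v \<Rightarrow> real" and \<beta> :: real
  assumes graph: "simple_graph V E"
    and K_ge_1: "K \<ge> 1"
    and lam_pos: "\<And>v. v \<in> V \<Longrightarrow> 0 < lam v"
    and p_bounds: "\<And>v. v \<in> V \<Longrightarrow> 0 \<le> p v \<and> p v \<le> 1"
    and \<beta>_pos: "\<beta> > 0"
    and drift: "\<And>v. v \<in> V \<Longrightarrow> 1 / real K * (\<Sum>u | u \<in> V \<and> {u, v} \<in> E. p u * (lam u / lam v)) \<le> 1 - \<beta>"
begin

abbreviation "\<Omega> \<equiv> mch_space V E K"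

abbreviation "lam_min \<equiv> Min (lam ` V)"

definition "total_rate = (\<Sum>v\<in>V. lam v)"

text \<open>Selections that leave the configuration unchanged count as steps; this gives the rate
  matrix the form \<open>total_rate\<close> times (\<open>jump\<close> minus the identity).\<close>

definition "jump x y = (\<Sum>v\<in>V. lam v / total_rate * pmf (mch_update E K p v x) y)"

text \<open>An active and an inactive vertex are at distance 1, two distinct active colours at
  distance 2. The weight 2 makes the number of colours blocked by a neighbour in exactly one of
  two configurations at most its distance, so the hypothesis loses no factor 2.\<close>

definition "colour_dist a b = (\<Sum>k=1..K. \<bar>of_bool (a = k) - of_bool (b = k)\<bar> :: real)"

definition "config_dist x y = (\<Sum>v\<in>V. colour_dist (x v) (y v))"

definition "free v x k \<longleftrightarrow> (\<forall>u. {u, v} \<in> E \<longrightarrow> x u \<noteq> k)"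

text \<open>The update for a successful coin with the drawn colour as an explicit argument, so that
  two configurations can be updated with the same colour.\<close>

definition "recolour v k x = (if free v x k then x(v := k) else x(v := 0))"

section \<open>State space and single-vertex updates\<close>

lemma finite_V: "finite V" and V_nonempty: "V \<noteq> {}"
  using graph by (auto simp: simple_graph_def)

lemma edge_vertices: "{u, v} \<in> E \<Longrightarrow> u \<in> V \<and> v \<in> V \<and> u \<noteq> v"
  using graph by (fastforce simp: simple_graph_def)

lemma finite_\<Omega>: "finite \<Omega>"
  using finite_V finite_PiE[of V "\<lambda>_. {0..K}"] by (simp add: mch_space_def)

lemma \<Omega>_nonempty: "\<Omega> \<noteq> {}"
proof -
  have "restrict (\<lambda>_. 0) V \<in> \<Omega>"
    using edge_vertices by (auto simp: mch_space_def proper_def)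
  then show ?thesis by blast
qed

lemma \<Omega>_le_K: "x \<in> \<Omega> \<Longrightarrow> v \<in> V \<Longrightarrow> x v \<le> K"
  by (auto simp: mch_space_def PiE_def Pi_def)

text \<open>Deactivating a vertex creates no conflict, since two adjacent vertices may both have
  colour 0.\<close>

lemma upd_0_in_\<Omega>: "x \<in> \<Omega> \<Longrightarrow> v \<in> V \<Longrightarrow> x(v := 0) \<in> \<Omega>"
  using edge_vertices
  by (auto simp: mch_space_def proper_def PiE_def Pi_def extensional_def)

lemma recolour_in_\<Omega>:
  assumes x: "x \<in> \<Omega>" and "v \<in> V" "k \<in> {1..K}"
  shows "recolour v k x \<in> \<Omega>"
proof (cases "free v x k")
  case True
  have "proper E (x(v := k))"
    unfolding proper_def
  proof (intro allI impI)
    fix a b assume ab: "{a, b} \<in> E \<and> 0 < (x(v := k)) a + (x(v := k)) b"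
    then have "a \<noteq> b" "{b, a} \<in> E" using edge_vertices[of a b] by (auto simp: insert_commute)
    then show "(x(v := k)) a \<noteq> (x(v := k)) b"
      using ab x True by (auto simp: free_def mch_space_def proper_def)
  qed
  moreover have "x(v := k) \<in> V \<rightarrow>\<^sub>E {0..K}"
    using assms by (auto simp: mch_space_def PiE_def Pi_def extensional_def)
  ultimately show ?thesis using True by (simp add: recolour_def mch_space_def)
next
  case False
  then show ?thesis using upd_0_in_\<Omega> assms by (simp add: recolour_def)
qed

lemma mch_update_eq:
  "mch_update E K p v x = bernoulli_pmf (p v) \<bind> (\<lambda>C. pmf_of_set {1..K} \<bind>
     (\<lambda>k. return_pmf (if C then recolour v k x else x(v := 0))))"
  unfolding mch_update_def recolour_def free_def
  by (intro bind_pmf_cong refl) auto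

lemma set_mch_update:
  assumes "x \<in> \<Omega>" "v \<in> V"
  shows "set_pmf (mch_update E K p v x) \<subseteq> \<Omega>"
  using assms recolour_in_\<Omega> upd_0_in_\<Omega> K_ge_1
  by (auto simp: mch_update_eq split: if_splits)

text \<open>Subtracting two instances of this average term by term plays the role of the coupling
  that gives both configurations the same coin and colour.\<close>

lemma mch_update_apply:
  assumes "x \<in> \<Omega>" "v \<in> V"
  shows "(\<Sum>z\<in>\<Omega>. pmf (mch_update E K p v x) z * f z) =
    p v / K * (\<Sum>k=1..K. f (recolour v k x)) + (1 - p v) * f (x(v := 0))" (is "?lhs = _")
proof -
  have colours: "{1..K} \<noteq> {}" "finite {1..K}" using K_ge_1 by auto
  have "?lhs = measure_pmf.expectation (mch_update E K p v x) f"
    using set_mch_update[OF assms] finite_\<Omega>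
    by (subst integral_measure_pmf[of \<Omega>]) auto
  also have "\<dots> = (\<Sum>C\<in>UNIV. pmf (bernoulli_pmf (p v)) C *
      ((\<Sum>k=1..K. f (if C then recolour v k x else x(v := 0))) / K))"
    unfolding mch_update_eq using colours
    by (subst pmf_expectation_bind[of UNIV])
       (auto simp: pmf_expectation_bind_pmf_of_set sum_distrib_left divide_inverse_commute intro!: sum.cong)
  also have "\<dots> = p v / K * (\<Sum>k=1..K. f (recolour v k x)) + (1 - p v) * f (x(v := 0))"
    using p_bounds[OF \<open>v \<in> V\<close>] K_ge_1 by (simp add: UNIV_bool)
  finally show ?thesis .
qed

section \<open>The distance of configurations\<close>

lemma colour_dist_nonneg: "0 \<le> colour_dist a b"
  by (simp add: colour_dist_def sum_nonneg)

lemma colour_dist_same: "colour_dist a a = 0"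
  by (simp add: colour_dist_def)

lemma colour_dist_ge_1:
  assumes "a \<le> K" "b \<le> K" "a \<noteq> b"
  shows "1 \<le> colour_dist a b"
proof -
  \<comment> \<open>The witness is \<open>a\<close> if it is active and \<open>b\<close>
    otherwise.\<close>
  obtain k where k: "k \<in> {1..K}" "\<bar>of_bool (a = k) - of_bool (b = k)\<bar> = (1 :: real)"
    using assms by (cases "a = 0") (force, auto intro!: that[of a])
  then show ?thesis
    unfolding colour_dist_def
    using member_le_sum[of k "{1..K}" "\<lambda>k. \<bar>of_bool (a = k) - of_bool (b = k)\<bar> :: real"] by simp
qed

lemma colour_dist_le_2: "colour_dist a b \<le> 2"
proof -
  have single: "(\<Sum>k=1..K. of_bool (a = k) :: real) \<le> 1" for a :: nat
    using sum.delta'[of "{1..K}" a "\<lambda>_. 1 :: real"] by (simp add: of_bool_def)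
  have "colour_dist a b \<le> (\<Sum>k=1..K. of_bool (a = k) + of_bool (b = k))"
    unfolding colour_dist_def by (intro sum_mono) auto
  also have "\<dots> \<le> 1 + 1"
    unfolding sum.distrib by (intro add_mono single)
  finally show ?thesis by simp
qed

text \<open>After both configurations try the same colour \<open>k\<close>, a disagreement at the
  vertex is between \<open>k\<close> and 0, never between two active colours, so its size is 1
  rather than 2.\<close>

lemma colour_dist_if_0:
  assumes "k \<in> {1..K}"
  shows "colour_dist (if P then k else 0) (if R then k else 0) = of_bool (P \<noteq> R)"
proof -
  have "(\<Sum>j=1..K. of_bool (k = j) :: real) = 1"
    using assms sum.delta'[of "{1..K}" k "\<lambda>_. 1 :: real"] by (simp add: of_bool_def)
  moreover have "(\<Sum>j=1..K. \<bar>of_bool (k = j) - of_bool (0 = j)\<bar> :: real) = (\<Sum>j=1..K. of_bool (k = j))"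
    "(\<Sum>j=1..K. \<bar>of_bool (0 = j) - of_bool (k = j)\<bar> :: real) = (\<Sum>j=1..K. of_bool (k = j))"
    by (auto intro!: sum.cong)
  ultimately show ?thesis by (auto simp: colour_dist_def)
qed

lemma config_dist_nonneg: "0 \<le> config_dist x y"
  by (simp add: config_dist_def sum_nonneg colour_dist_nonneg)

lemma config_dist_upd:
  assumes "v \<in> V"
  shows "config_dist (x(v := a)) (y(v := b)) = config_dist x y - colour_dist (x v) (y v) + colour_dist a b"
proof -
  have "(\<Sum>u\<in>V - {v}. colour_dist ((x(v := a)) u) ((y(v := b)) u)) = (\<Sum>u\<in>V - {v}. colour_dist (x u) (y u))"
    by (intro sum.cong) auto
  then show ?thesis
    unfolding config_dist_def
    using sum.remove[OF finite_V assms, of "\<lambda>u. colour_dist ((x(v := a)) u) ((y(v := b)) u)"]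
      sum.remove[OF finite_V assms, of "\<lambda>u. colour_dist (x u) (y u)"]
    by simp
qed

lemma config_dist_ge:
  assumes "x \<in> \<Omega>" "y \<in> \<Omega>"
  shows "of_bool (x \<noteq> y) \<le> config_dist x y"
proof (cases "x = y")
  case True
  then show ?thesis using config_dist_nonneg by simp
next
  case False
  have "x \<in> V \<rightarrow>\<^sub>E {0..K}" "y \<in> V \<rightarrow>\<^sub>E {0..K}"
    using assms by (simp_all add: mch_space_def)
  then have "\<exists>v\<in>V. x v \<noteq> y v"
    using PiE_ext[of x V "\<lambda>_. {0..K}" y] False by blast
  then obtain v where v: "v \<in> V" "x v \<noteq> y v" by blast
  have "1 \<le> colour_dist (x v) (y v)"
    using v assms \<Omega>_le_K by (intro colour_dist_ge_1) auto
  also have "\<dots> \<le> config_dist x y"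
    unfolding config_dist_def
    by (rule member_le_sum[OF v(1) colour_dist_nonneg finite_V])
  finally show ?thesis using False by simp
qed

lemma config_dist_le: "config_dist x y \<le> 2 * real (card V)"
  unfolding config_dist_def
  using sum_mono[of V "\<lambda>v. colour_dist (x v) (y v)" "\<lambda>_. 2"] colour_dist_le_2 by simp

text \<open>A new disagreement at \<open>v\<close> means that \<open>k\<close> is blocked in exactly
  one configuration. It is charged to a neighbour that has colour \<open>k\<close> in exactly one of
  them.\<close>

lemma config_dist_recolour:
  assumes "v \<in> V" "k \<in> {1..K}"
  shows "config_dist (recolour v k x) (recolour v k y) \<le> config_dist x y - colour_dist (x v) (y v)
    + (\<Sum>u | u \<in> V \<and> {u, v} \<in> E. \<bar>of_bool (x u = k) - of_bool (y u = k)\<bar>)" (is "_ \<le> _ + ?nb")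
proof -
  have "of_bool (free v x k \<noteq> free v y k) \<le> ?nb"
  proof (cases "free v x k = free v y k")
    case True
    then show ?thesis by (simp add: sum_nonneg)
  next
    case False
    then obtain u where u: "{u, v} \<in> E" "(x u = k) \<noteq> (y u = k)"
      unfolding free_def by blast
    have "\<bar>of_bool (x u = k) - of_bool (y u = k)\<bar> \<le> ?nb"
      by (rule member_le_sum[of u _ "\<lambda>u. \<bar>of_bool (x u = k) - of_bool (y u = k)\<bar>"])
        (use u edge_vertices finite_V in auto)
    then show ?thesis using u False by auto
  qed
  moreover have "recolour v k z = z(v := (if free v z k then k else 0))" for z
    by (simp add: recolour_def)
  ultimately show ?thesis
    using assms by (simp add: config_dist_upd colour_dist_if_0)
qed

section \<open>Contraction of the jump chain\<close>

lemma mch_update_lipschitz: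
  assumes f: "\<And>x y. x \<in> \<Omega> \<Longrightarrow> y \<in> \<Omega> \<Longrightarrow> \<bar>f x - f y\<bar> \<le> L * config_dist x y"
    and "0 \<le> L" and x: "x \<in> \<Omega>" and y: "y \<in> \<Omega>" and v: "v \<in> V"
  shows "\<bar>(\<Sum>z\<in>\<Omega>. pmf (mch_update E K p v x) z * f z) - (\<Sum>z\<in>\<Omega>. pmf (mch_update E K p v y) z * f z)\<bar>
    \<le> L * (config_dist x y - colour_dist (x v) (y v)
         + p v / K * (\<Sum>u | u \<in> V \<and> {u, v} \<in> E. colour_dist (x u) (y u)))"
proof -
  let ?r = "config_dist x y - colour_dist (x v) (y v)"
  let ?nb = "{u. u \<in> V \<and> {u, v} \<in> E}"
  have p: "0 \<le> p v" "0 \<le> 1 - p v" using p_bounds[OF v] by auto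
  have "\<bar>f (recolour v k x) - f (recolour v k y)\<bar>
      \<le> L * (?r + (\<Sum>u\<in>?nb. \<bar>of_bool (x u = k) - of_bool (y u = k)\<bar>))" if k: "k \<in> {1..K}" for k
    using f[OF recolour_in_\<Omega>[OF x v k] recolour_in_\<Omega>[OF y v k]]
      mult_left_mono[OF config_dist_recolour[OF v k, of x y] \<open>0 \<le> L\<close>] by linarith
  then have "(\<Sum>k=1..K. \<bar>f (recolour v k x) - f (recolour v k y)\<bar>)
      \<le> (\<Sum>k=1..K. L * (?r + (\<Sum>u\<in>?nb. \<bar>of_bool (x u = k) - of_bool (y u = k)\<bar>)))"
    by (rule sum_mono)
  also have "\<dots> = L * (K * ?r + (\<Sum>k=1..K. \<Sum>u\<in>?nb. \<bar>of_bool (x u = k) - of_bool (y u = k)\<bar>))"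
    by (simp add: sum_distrib_left[symmetric] sum.distrib)
  \<comment> \<open>Summed over all colours, the charges to a neighbour add up to exactly its
    \<open>colour_dist\<close>.\<close>
  also have "(\<Sum>k=1..K. \<Sum>u\<in>?nb. \<bar>of_bool (x u = k) - of_bool (y u = k)\<bar>)
      = (\<Sum>u\<in>?nb. colour_dist (x u) (y u))"
    unfolding colour_dist_def by (rule sum.swap)
  finally have active: "\<bar>(\<Sum>k=1..K. f (recolour v k x) - f (recolour v k y))\<bar>
      \<le> L * (K * ?r + (\<Sum>u\<in>?nb. colour_dist (x u) (y u)))"
    by (rule order.trans[OF sum_abs])
  \<comment> \<open>A failed coin sets \<open>v\<close> to 0 in both configurations, so the
    disagreement at \<open>v\<close> disappears and none replaces it.\<close>
  have inactive: "\<bar>f (x(v := 0)) - f (y(v := 0))\<bar> \<le> L * ?r"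
    using f[OF upd_0_in_\<Omega>[OF x v] upd_0_in_\<Omega>[OF y v]]
    by (simp add: config_dist_upd[OF v] colour_dist_same)
  let ?A = "\<Sum>k=1..K. f (recolour v k x) - f (recolour v k y)"
  let ?I = "f (x(v := 0)) - f (y(v := 0))"
  let ?n = "\<Sum>u\<in>?nb. colour_dist (x u) (y u)"
  have "\<bar>(\<Sum>z\<in>\<Omega>. pmf (mch_update E K p v x) z * f z) - (\<Sum>z\<in>\<Omega>. pmf (mch_update E K p v y) z * f z)\<bar>
      = \<bar>p v / K * ?A + (1 - p v) * ?I\<bar>"
    by (simp only: mch_update_apply x y v sum_subtractf) (simp add: algebra_simps)
  also have "\<dots> \<le> \<bar>p v / K * ?A\<bar> + \<bar>(1 - p v) * ?I\<bar>"
    by (rule abs_triangle_ineq)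
  also have "\<dots> = p v / K * \<bar>?A\<bar> + (1 - p v) * \<bar>?I\<bar>"
    using p by (simp add: abs_mult)
  also have "\<dots> \<le> p v / K * (L * (K * ?r + ?n)) + (1 - p v) * (L * ?r)"
    by (rule add_mono[OF mult_left_mono[OF active] mult_left_mono[OF inactive]]) (use p in auto)
  also have "\<dots> = L * (?r + p v / K * ?n)"
  proof -
    have "p v / K * (L * (K * r + n)) + (1 - p v) * (L * r) = L * (r + p v / K * n)" for r n :: real
      using K_ge_1 by (simp add: field_simps)
    then show ?thesis .
  qed
  finally show ?thesis .
qed

lemma lam_min_pos: "0 < lam_min"
  using finite_V V_nonempty lam_pos by (subst Min_gr_iff) auto

lemma lam_min_le: "v \<in> V \<Longrightarrow> lam_min \<le> lam v"
  using finite_V by simp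

lemma total_rate_pos: "0 < total_rate"
  unfolding total_rate_def using finite_V V_nonempty lam_pos by (intro sum_pos) auto

lemma lam_min_le_total_rate: "lam_min \<le> total_rate"
proof -
  obtain v where v: "v \<in> V" using V_nonempty by blast
  have "lam v \<le> total_rate"
    unfolding total_rate_def
    by (rule member_le_sum[OF v _ finite_V]) (use lam_pos in \<open>auto intro: less_imp_le\<close>)
  then show ?thesis using lam_min_le[OF v] by simp
qed

text \<open>The left side of \<open>drift\<close> is nonnegative. Together with
  \<open>lam_min_le_total_rate\<close> this makes the contraction factor of the jump chain
  nonnegative.\<close>

lemma \<beta>_le_1: "\<beta> \<le> 1"
proof -
  obtain v where v: "v \<in> V" using V_nonempty by blast
  have "0 \<le> 1 / real K * (\<Sum>u | u \<in> V \<and> {u, v} \<in> E. p u * (lam u / lam v))"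
    using v p_bounds lam_pos
    by (intro mult_nonneg_nonneg sum_nonneg divide_nonneg_nonneg) (auto intro: less_imp_le)
  then show ?thesis using drift[OF v] by simp
qed

text \<open>A disagreement at \<open>u\<close> is removed at rate \<open>lam u\<close> and spreads
  to the neighbours of \<open>u\<close> at a total weighted rate of at most (1 - \<beta>)
  \<open>lam u\<close>, by the hypothesis at \<open>u\<close>. The net loss is at least \<beta>
  \<open>lam u\<close>, hence at least \<beta> \<open>lam_min\<close>.\<close>

lemma total_drift_le:
  "(\<Sum>v\<in>V. lam v * (config_dist x y - colour_dist (x v) (y v)
      + p v / K * (\<Sum>u | u \<in> V \<and> {u, v} \<in> E. colour_dist (x u) (y u))))
    \<le> (total_rate - \<beta> * lam_min) * config_dist x y"
proof -
  let ?d = "\<lambda>v. colour_dist (x v) (y v)"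
  have "(\<Sum>v\<in>V. lam v * (p v / K * (\<Sum>u | u \<in> V \<and> {u, v} \<in> E. ?d u)))
      = (\<Sum>v\<in>V. \<Sum>u | u \<in> V \<and> {u, v} \<in> E. lam v * p v / K * ?d u)"
    by (simp add: sum_distrib_left mult_ac)
  \<comment> \<open>The spreading terms are regrouped by the vertex \<open>u\<close> that causes
    them instead of the updated vertex \<open>v\<close>; this is the form to which
    \<open>drift\<close> applies.\<close>
  also have "\<dots> = (\<Sum>u\<in>V. \<Sum>v | v \<in> V \<and> {u, v} \<in> E. lam v * p v / K * ?d u)"
    using finite_V by (rule sum.swap_restrict[OF _ finite_V])
  also have "\<dots> \<le> (\<Sum>u\<in>V. (1 - \<beta>) * lam u * ?d u)"
  proof (rule sum_mono)
    fix u assume u: "u \<in> V"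
    have "(\<Sum>v | v \<in> V \<and> {u, v} \<in> E. lam v * p v / K * ?d u) =
        lam u * ?d u * (1 / K * (\<Sum>v | v \<in> V \<and> {v, u} \<in> E. p v * (lam v / lam u)))"
      using lam_pos[OF u] by (simp add: sum_distrib_left insert_commute mult_ac)
    also have "\<dots> \<le> lam u * ?d u * (1 - \<beta>)"
      using drift[OF u] lam_pos[OF u] colour_dist_nonneg by (intro mult_left_mono) auto
    finally show "(\<Sum>v | v \<in> V \<and> {u, v} \<in> E. lam v * p v / K * ?d u) \<le> (1 - \<beta>) * lam u * ?d u"
      by (simp add: mult_ac)
  qed
  finally have "(\<Sum>v\<in>V. lam v * (config_dist x y - ?d v + p v / K * (\<Sum>u | u \<in> V \<and> {u, v} \<in> E. ?d u)))
      \<le> (\<Sum>v\<in>V. lam v * (config_dist x y - ?d v)) + (\<Sum>u\<in>V. (1 - \<beta>) * lam u * ?d u)"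
    by (simp add: distrib_left sum.distrib)
  also have "\<dots> = total_rate * config_dist x y - \<beta> * (\<Sum>v\<in>V. lam v * ?d v)"
    by (simp add: total_rate_def sum_distrib_left sum_distrib_right sum.distrib[symmetric]
        sum_subtractf[symmetric] algebra_simps)
  also have "(\<Sum>v\<in>V. lam v * ?d v) \<ge> lam_min * config_dist x y"
    unfolding config_dist_def sum_distrib_left
    by (intro sum_mono mult_right_mono lam_min_le colour_dist_nonneg)
  then have "total_rate * config_dist x y - \<beta> * (\<Sum>v\<in>V. lam v * ?d v)
      \<le> total_rate * config_dist x y - \<beta> * (lam_min * config_dist x y)"
    using \<beta>_pos by simp
  finally show ?thesis by (simp add: left_diff_distrib mult.assoc)
qed

lemma jump_apply:
  "(\<Sum>z\<in>\<Omega>. jump x z * f z) =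
    (\<Sum>v\<in>V. lam v / total_rate * (\<Sum>z\<in>\<Omega>. pmf (mch_update E K p v x) z * f z))"
proof -
  have "(\<Sum>z\<in>\<Omega>. jump x z * f z) =
      (\<Sum>z\<in>\<Omega>. \<Sum>v\<in>V. lam v / total_rate * (pmf (mch_update E K p v x) z * f z))"
    by (simp add: jump_def sum_distrib_right mult.assoc)
  also have "\<dots> = (\<Sum>v\<in>V. \<Sum>z\<in>\<Omega>. lam v / total_rate * (pmf (mch_update E K p v x) z * f z))"
    by (rule sum.swap)
  finally show ?thesis by (simp add: sum_distrib_left)
qed

text \<open>The factor \<open>c\<close> is chosen so that \<open>total_rate\<close> times
  \<open>1 - c\<close> equals \<beta> \<open>lam_min\<close>; the total rate thus cancels from the
  exponent in continuous time.\<close>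

lemma contractive_chain_mch:
  "contractive_chain \<Omega> jump (mch_rates V E K lam p) total_rate
    (1 - \<beta> * lam_min / total_rate) (2 * real (card V)) config_dist"
proof
  show "mch_rates V E K lam p x y = total_rate * (jump x y - of_bool (x = y))" for x y
    using total_rate_pos
    by (simp add: mch_rates_def jump_def right_diff_distrib sum_subtractf sum_distrib_left
        sum_distrib_right[symmetric] total_rate_def[symmetric])
  show "0 \<le> jump x y" for x y
    unfolding jump_def using lam_pos total_rate_pos
    by (intro sum_nonneg mult_nonneg_nonneg divide_nonneg_nonneg) (auto intro: less_imp_le)
  show "(\<Sum>y\<in>\<Omega>. jump x y) = 1" if "x \<in> \<Omega>" for x
  proof -
    have "(\<Sum>z\<in>\<Omega>. pmf (mch_update E K p v x) z) = 1" if "v \<in> V" for v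
      using finite_\<Omega> set_mch_update[OF \<open>x \<in> \<Omega>\<close> that] by (rule sum_pmf_eq_1)
    then show ?thesis
      using jump_apply[of x "\<lambda>_. 1"] total_rate_pos
      by (simp add: sum_divide_distrib[symmetric] total_rate_def[symmetric])
  qed
  have "\<beta> * lam_min \<le> 1 * total_rate"
    using \<beta>_le_1 \<beta>_pos lam_min_le_total_rate lam_min_pos by (intro mult_mono) auto
  then show "0 \<le> 1 - \<beta> * lam_min / total_rate"
    using total_rate_pos by simp
  show "1 - \<beta> * lam_min / total_rate < 1"
    using \<beta>_pos lam_min_pos total_rate_pos by simp
  show "finite \<Omega>" "\<Omega> \<noteq> {}" "0 \<le> total_rate"
    using finite_\<Omega> \<Omega>_nonempty total_rate_pos by simp_all
  show "of_bool (x \<noteq> y) \<le> config_dist x y" if "x \<in> \<Omega>" "y \<in> \<Omega>" for x y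
    using that by (rule config_dist_ge)
  show "config_dist x y \<le> 2 * real (card V)" for x y
    by (rule config_dist_le)
next
  fix f :: "('v \<Rightarrow> nat) \<Rightarrow> real" and L x y
  assume "0 \<le> L" and f: "\<And>x y. x \<in> \<Omega> \<Longrightarrow> y \<in> \<Omega> \<Longrightarrow> \<bar>f x - f y\<bar> \<le> L * config_dist x y"
    and xy: "x \<in> \<Omega>" "y \<in> \<Omega>"
  let ?U = "\<lambda>v x. \<Sum>z\<in>\<Omega>. pmf (mch_update E K p v x) z * f z"
  let ?b = "\<lambda>v. config_dist x y - colour_dist (x v) (y v)
         + p v / K * (\<Sum>u | u \<in> V \<and> {u, v} \<in> E. colour_dist (x u) (y u))"
  have scale: "(\<Sum>v\<in>V. lam v / total_rate * (L * b v)) = L / total_rate * (\<Sum>v\<in>V. lam v * b v)" for b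
    by (simp add: sum_distrib_left mult_ac)
  have "\<bar>(\<Sum>z\<in>\<Omega>. jump x z * f z) - (\<Sum>z\<in>\<Omega>. jump y z * f z)\<bar>
      = \<bar>\<Sum>v\<in>V. lam v / total_rate * (?U v x - ?U v y)\<bar>"
    unfolding jump_apply by (simp only: right_diff_distrib sum_subtractf)
  also have "\<dots> \<le> (\<Sum>v\<in>V. lam v / total_rate * (L * ?b v))"
  proof (rule order.trans[OF sum_abs sum_mono])
    fix v assume v: "v \<in> V"
    have "0 < lam v / total_rate" using lam_pos[OF v] total_rate_pos by simp
    then show "\<bar>lam v / total_rate * (?U v x - ?U v y)\<bar> \<le> lam v / total_rate * (L * ?b v)"
      using mch_update_lipschitz[OF f \<open>0 \<le> L\<close> xy v]
      by (simp only: abs_mult abs_of_pos) (rule mult_left_mono, auto)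
  qed
  also have "\<dots> = L / total_rate * (\<Sum>v\<in>V. lam v * ?b v)"
    by (simp only: scale)
  also have "\<dots> \<le> L / total_rate * ((total_rate - \<beta> * lam_min) * config_dist x y)"
    using \<open>0 \<le> L\<close> total_rate_pos by (intro mult_left_mono total_drift_le) auto
  also have "\<dots> = (1 - \<beta> * lam_min / total_rate) * L * config_dist x y"
    using total_rate_pos by (simp add: field_simps)
  finally show "\<bar>(\<Sum>z\<in>\<Omega>. jump x z * f z) - (\<Sum>z\<in>\<Omega>. jump y z * f z)\<bar>
      \<le> (1 - \<beta> * lam_min / total_rate) * L * config_dist x y" .
qed

lemma contraction_rate: "total_rate * (1 - (1 - \<beta> * lam_min / total_rate)) = \<beta> * lam_min"
  using total_rate_pos by simp

end

section \<open>Total variation and mixing time of the hardcore model\<close>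

theorem theorem1:
  fixes V :: "'v set" and E :: "'v set set" and K :: nat
    and lam p :: "'v \<Rightarrow> real" and \<beta> :: real
  defines "\<Omega> \<equiv> mch_space V E K"
    and "Q \<equiv> mch_rates V E K lam p"
    and "lam_min \<equiv> Min (lam ` V)"
  assumes "simple_graph V E"
    and "K \<ge> 1"
    and "\<forall>v\<in>V. 0 < lam v"
    and "\<forall>v\<in>V. 0 \<le> p v \<and> p v \<le> 1"
    and "\<beta> > 0"
    and "\<forall>v\<in>V. 1 / real K * (\<Sum>u | u \<in> V \<and> {u, v} \<in> E. p u * (lam u / lam v)) \<le> 1 - \<beta>"
  shows "(\<forall>(PX :: ('v \<Rightarrow> nat) \<Rightarrow> 'a measure) (X :: real \<Rightarrow> 'a \<Rightarrow> 'v \<Rightarrow> nat)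
           (PY :: ('v \<Rightarrow> nat) \<Rightarrow> 'b measure) (Y :: real \<Rightarrow> 'b \<Rightarrow> 'v \<Rightarrow> nat).
            (\<forall>x\<in>\<Omega>. markov_chain \<Omega> Q x (PX x) X) \<and>
            (\<forall>y\<in>\<Omega>. markov_chain \<Omega> Q y (PY y) Y) \<longrightarrow>
            (\<forall>t\<ge>0.
              (MAX x\<in>\<Omega>. MAX y\<in>\<Omega>.
                 tv_dist \<Omega> (distr (PX x) (count_space \<Omega>) (X t))
                           (distr (PY y) (count_space \<Omega>) (Y t)))
              \<le> min (2 * real (card V) * exp (- \<beta> * lam_min * t)) 1))
       \<and> (\<forall>\<epsilon>. 0 < \<epsilon> \<and> \<epsilon> < 1 \<longrightarrow>
            mixing_time \<Omega> Q \<epsilon> \<le> ereal (1 / (\<beta> * lam_min) * ln (2 * real (card V) / \<epsilon>)))"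
proof -
  interpret mch V E K lam p \<beta>
    using assms by unfold_locales auto
  interpret contractive_chain \<Omega> jump Q total_rate "1 - \<beta> * lam_min / total_rate"
    "2 * real (card V)" config_dist
    unfolding \<Omega>_def Q_def lam_min_def by (rule contractive_chain_mch)
  have rate: "- total_rate * (1 - (1 - \<beta> * lam_min / total_rate)) * t = - \<beta> * lam_min * t" for t
    using contraction_rate unfolding lam_min_def by (simp only: minus_mult_left[symmetric])
  have card: "1 \<le> real (card V)"
    using finite_V V_nonempty by (simp add: Suc_le_eq card_gt_0_iff)
  show ?thesis
  proof (intro conjI allI impI; (elim conjE)?)
    fix PX :: "('v \<Rightarrow> nat) \<Rightarrow> 'a measure" and X PY and Y :: "real \<Rightarrow> 'b \<Rightarrow> 'v \<Rightarrow> nat" and t :: real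
    assume "\<forall>x\<in>\<Omega>. markov_chain \<Omega> Q x (PX x) X" "\<forall>y\<in>\<Omega>. markov_chain \<Omega> Q y (PY y) Y" "0 \<le> t"
    from tv_dist_markov_chains_le[OF this]
    show "(MAX x\<in>\<Omega>. MAX y\<in>\<Omega>. tv_dist \<Omega> (distr (PX x) (count_space \<Omega>) (X t))
                           (distr (PY y) (count_space \<Omega>) (Y t)))
              \<le> min (2 * real (card V) * exp (- \<beta> * lam_min * t)) 1"
      by (simp only: rate)
  next
    fix \<epsilon> :: real assume \<epsilon>: "0 < \<epsilon>" "\<epsilon> < 1"
    \<comment> \<open>The time at which \<open>2 * card V * exp (- \<beta> * lam_min * t)\<close>
      equals \<epsilon>; it is nonnegative because the argument of the logarithm is at least
      1.\<close>
    define t where "t = 1 / (\<beta> * lam_min) * ln (2 * real (card V) / \<epsilon>)"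
    have pos: "0 < \<beta> * lam_min" using \<beta>_pos lam_min_pos by (simp add: lam_min_def)
    have "1 \<le> 2 * real (card V) / \<epsilon>" using \<epsilon> card by (simp add: field_simps)
    then have "0 \<le> t" using pos by (simp add: t_def)
    have "- \<beta> * lam_min * t = - ln (2 * real (card V) / \<epsilon>)"
      using pos by (auto simp: t_def)
    then have "2 * real (card V) * exp (- \<beta> * lam_min * t) = \<epsilon>"
      using \<epsilon> card by (simp add: exp_minus)
    then have "mixing_time \<Omega> Q \<epsilon> \<le> ereal t"
      by (intro mixing_time_le total_rate_pos \<open>0 \<le> t\<close>) (simp only: rate order.refl)
    then show "mixing_time \<Omega> Q \<epsilon> \<le> ereal (1 / (\<beta> * lam_min) * ln (2 * real (card V) / \<epsilon>))"
      by (simp only: t_def)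
  qed
qed

end
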